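(* Let $R$ be a finite commutative ring with unity and let $S\subseteq R$ be a multiplicatively closed subset. If $R$ is an $S$-integral domain, then $R$ is an $S$-field.
   Context: A multiplicatively closed subset $S$ of a commutative ring $R$ is a subset with $1\in S$, $0\notin S$, and $st\in S$ for all $s,t\in S$. The ring $R$ is an $S$-integral domain if there exists $s\in S$ such that for all $a,b\in R$ with $ab=0$, either $sa=0$ or $sb=0$. An ideal $I$ of $R$ with $I\cap S=\emptyset$ is $S$-maximal if there exists $s\in S$ such that for every ideal $J$ of $R$ with $I\subseteq J$, either $sJ\subseteq I$ or $J\cap S\neq\emptyset$. The ring $R$ is an $S$-field if its zero ideal $(0)$ is an $S$-maximal ideal of $R$. *)

theory Defs
  imports "HOL-Algebra.Algebra"
begin

definition mult_closed_subset :: "('a, 'm) ring_scheme \<Rightarrow> 'a set \<Rightarrow> bool" where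
  "mult_closed_subset R S \<longleftrightarrow> submonoid S R \<and> \<zero>\<^bsub>R\<^esub> \<notin> S"

text \<open>The notions below are meant for a commutative ring \<open>R\<close> and a multiplicatively closed
  subset \<open>S\<close> of \<open>R\<close>; these are not part of the definitions and have to be assumed separately.\<close>

definition S_integral_domain :: "('a, 'm) ring_scheme \<Rightarrow> 'a set \<Rightarrow> bool" where
  "S_integral_domain R S \<longleftrightarrow>
     (\<exists>s\<in>S. \<forall>a\<in>carrier R. \<forall>b\<in>carrier R.
        a \<otimes>\<^bsub>R\<^esub> b = \<zero>\<^bsub>R\<^esub> \<longrightarrow> s \<otimes>\<^bsub>R\<^esub> a = \<zero>\<^bsub>R\<^esub> \<or> s \<otimes>\<^bsub>R\<^esub> b = \<zero>\<^bsub>R\<^esub>)"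

text \<open>The set \<open>sJ\<close> is the left coset \<open>s <# J\<close> with respect to the multiplication of \<open>R\<close>.
  The witness \<open>s\<close> is chosen uniformly in \<open>J\<close>.\<close>

definition S_maximal_ideal :: "('a, 'm) ring_scheme \<Rightarrow> 'a set \<Rightarrow> 'a set \<Rightarrow> bool" where
  "S_maximal_ideal R S I \<longleftrightarrow>
     ideal I R \<and> I \<inter> S = {} \<and>
     (\<exists>s\<in>S. \<forall>J. ideal J R \<longrightarrow> I \<subseteq> J \<longrightarrow> s <#\<^bsub>R\<^esub> J \<subseteq> I \<or> J \<inter> S \<noteq> {})"

definition S_field :: "('a, 'm) ring_scheme \<Rightarrow> 'a set \<Rightarrow> bool" where
  "S_field R S \<longleftrightarrow> S_maximal_ideal R S {\<zero>\<^bsub>R\<^esub>}"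

end

theory Submission
  imports Defs
begin

text \<open>
  Let \<open>s \<in> S\<close> be a witness for the \<open>S\<close>-integral domain property. Although it only speaks of
  products \<open>ab = 0\<close>, the annihilator \<open>(0 : s)\<close> is even prime, because powers of \<open>s\<close> stay in \<open>S\<close>
  and are therefore nonzero (\<open>S_domain_witness_prime\<close>). Hence an element \<open>a\<close> with \<open>sa \<noteq> 0\<close> is
  cancellable on the principal ideal \<open>sR\<close>, and finiteness turns this injective multiplication into
  a surjective one (\<open>cancellable_on_finite_multiples\<close>): \<open>s\<close> itself is a multiple of \<open>a\<close>.
  So every ideal \<open>J\<close> with \<open>sJ \<noteq> 0\<close> contains \<open>s\<close> and meets \<open>S\<close>. This is the classical argument
  that finite domains are fields, applied to \<open>sR\<close>, which is isomorphic to the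
  finite domain \<open>R/(0 : s)\<close> as an \<open>R\<close>-module.
\<close>

text \<open>
  The hypothesis is used twice: for the product of \<open>sa\<close> and \<open>b\<close>, which leaves the unwanted
  alternative \<open>s\<^sup>2a = 0\<close>, and for the product of \<open>s\<^sup>2\<close> and \<open>a\<close>, where \<open>s\<^sup>3 \<noteq> 0\<close> reduces that
  alternative to \<open>sa = 0\<close>.
\<close>

lemma (in cring) S_domain_witness_prime:
  assumes S: "mult_closed_subset R S" and s: "s \<in> S"
    and witness: "\<And>a b. \<lbrakk>a \<in> carrier R; b \<in> carrier R; a \<otimes> b = \<zero>\<rbrakk>
        \<Longrightarrow> s \<otimes> a = \<zero> \<or> s \<otimes> b = \<zero>"
    and a: "a \<in> carrier R" and b: "b \<in> carrier R"
    and sab: "s \<otimes> (a \<otimes> b) = \<zero>"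
  shows "s \<otimes> a = \<zero> \<or> s \<otimes> b = \<zero>"
proof -
  interpret S: submonoid S R using S by (simp add: mult_closed_subset_def)
  have sc: "s \<in> carrier R" using s S.subset by blast
  have "(s \<otimes> a) \<otimes> b = \<zero>" using sab a b sc by (simp add: m_assoc)
  then consider "s \<otimes> (s \<otimes> a) = \<zero>" | "s \<otimes> b = \<zero>"
    using witness[of "s \<otimes> a" b] a b sc by auto
  then show ?thesis
  proof cases
    case 1
    then have "(s \<otimes> s) \<otimes> a = \<zero>" using a sc by (simp add: m_assoc)
    then have "s \<otimes> (s \<otimes> s) = \<zero> \<or> s \<otimes> a = \<zero>"
      using witness[of "s \<otimes> s" a] a sc by auto
    moreover have "s \<otimes> (s \<otimes> s) \<in> S" using s by simp
    ultimately show ?thesis using S by (auto simp: mult_closed_subset_def)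
  qed simp
qed

lemma (in cring) cancellable_on_finite_multiples:
  assumes fin: "finite (carrier R)"
    and s: "s \<in> carrier R" and a: "a \<in> carrier R"
    and cancel: "\<And>x. \<lbrakk>x \<in> carrier R; s \<otimes> (a \<otimes> x) = \<zero>\<rbrakk> \<Longrightarrow> s \<otimes> x = \<zero>"
  shows "\<exists>r\<in>carrier R. s = a \<otimes> r"
proof -
  define M where "M = (\<lambda>x. s \<otimes> x) ` carrier R"
  have "finite M" using fin by (simp add: M_def)
  moreover have "(\<otimes>) a ` M \<subseteq> M"
  proof
    fix y assume "y \<in> (\<otimes>) a ` M"
    then obtain x where "x \<in> carrier R" "y = a \<otimes> (s \<otimes> x)" by (auto simp: M_def)
    then have "y = s \<otimes> (a \<otimes> x)" "a \<otimes> x \<in> carrier R" using a s by (auto simp: m_lcomm)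
    then show "y \<in> M" by (simp add: M_def)
  qed
  moreover have "inj_on ((\<otimes>) a) M"
  proof (rule inj_onI)
    fix u v assume "u \<in> M" "v \<in> M" and eq: "a \<otimes> u = a \<otimes> v"
    then obtain x y where xy: "x \<in> carrier R" "y \<in> carrier R"
      and uv: "u = s \<otimes> x" "v = s \<otimes> y" by (auto simp: M_def)
    have "s \<otimes> (a \<otimes> x) = s \<otimes> (a \<otimes> y)" using eq uv a s xy by (simp add: m_lcomm)
    then have "s \<otimes> (a \<otimes> (x \<ominus> y)) = \<zero>"
      using a s xy by (simp add: minus_eq r_distr r_minus r_neg)
    then have "s \<otimes> (x \<ominus> y) = \<zero>" using cancel xy by simp
    then have "s \<otimes> x \<ominus> s \<otimes> y = \<zero>" using s xy by (simp add: minus_eq r_distr r_minus)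
    then show "u = v" using uv s xy by simp
  qed
  ultimately have "(\<otimes>) a ` M = M" by (intro endo_inj_surj)
  moreover have "s \<in> M" using s unfolding M_def by (intro image_eqI[of _ _ \<one>]) auto
  ultimately obtain x where "x \<in> carrier R" "s = a \<otimes> (s \<otimes> x)" by (auto simp: M_def)
  then show ?thesis using s by blast
qed

theorem corollary3p20:
  fixes R :: "('a, 'm) ring_scheme" and S :: "'a set"
  assumes "cring R"
    and "finite (carrier R)"
    and "mult_closed_subset R S"
    and "S_integral_domain R S"
  shows "S_field R S"
proof -
  interpret cring R by fact
  obtain s where s: "s \<in> S"
    and witness: "\<And>a b. \<lbrakk>a \<in> carrier R; b \<in> carrier R; a \<otimes>\<^bsub>R\<^esub> b = \<zero>\<^bsub>R\<^esub>\<rbrakk>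
        \<Longrightarrow> s \<otimes>\<^bsub>R\<^esub> a = \<zero>\<^bsub>R\<^esub> \<or> s \<otimes>\<^bsub>R\<^esub> b = \<zero>\<^bsub>R\<^esub>"
    using assms(4) by (auto simp: S_integral_domain_def)
  have sc: "s \<in> carrier R"
    using s assms(3) by (auto simp: mult_closed_subset_def dest: submonoid.subset)
  have "s <#\<^bsub>R\<^esub> J \<subseteq> {\<zero>\<^bsub>R\<^esub>} \<or> J \<inter> S \<noteq> {}" if J: "ideal J R" for J
  proof (cases "\<exists>a\<in>J. s \<otimes>\<^bsub>R\<^esub> a \<noteq> \<zero>\<^bsub>R\<^esub>")
    case True
    then obtain a where a: "a \<in> J" "s \<otimes>\<^bsub>R\<^esub> a \<noteq> \<zero>\<^bsub>R\<^esub>" by blast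
    have ac: "a \<in> carrier R" using ideal.Icarr[OF J] a(1) by blast
    have "s \<otimes>\<^bsub>R\<^esub> x = \<zero>\<^bsub>R\<^esub>" if "x \<in> carrier R" "s \<otimes>\<^bsub>R\<^esub> (a \<otimes>\<^bsub>R\<^esub> x) = \<zero>\<^bsub>R\<^esub>" for x
      using S_domain_witness_prime[OF assms(3) s witness ac that] a(2) by blast
    then obtain r where "r \<in> carrier R" "s = a \<otimes>\<^bsub>R\<^esub> r"
      using cancellable_on_finite_multiples[OF assms(2) sc ac] by blast
    then have "s \<in> J" using ideal.I_r_closed[OF J a(1)] by simp
    then show ?thesis using s by blast
  qed (auto simp: l_coset_def)
  moreover have "{\<zero>\<^bsub>R\<^esub>} \<inter> S = {}" using assms(3) by (simp add: mult_closed_subset_def)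
  ultimately show ?thesis
    unfolding S_field_def S_maximal_ideal_def using zeroideal s by blast
qed

end
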